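(* For nonzero integers $m,n$ let $BS(m,n)=\langle a,b \mid ab^{m}a^{-1}=b^{n}\rangle$, marked by $(a,b)$, and let $\mathbb{F}_2$ be the free group on $\{a,b\}$, marked by $(a,b)$. Then $BS(m,n)\to \mathbb{F}_2$ in the space $\mathcal{G}_2$ of marked groups on two generators when $|m|,|n|\to\infty$; that is, for every $\varepsilon>0$ there is $N$ such that $d\big(BS(m,n),\mathbb{F}_2\big)<\varepsilon$ for all integers $m,n$ with $|m|\geq N$ and $|n|\geq N$.
   Context: A marked group on $k$ generators is a pair $(\Gamma,S)$ with $\Gamma$ a group and $S=(s_1,\dots,s_k)$ a family generating $\Gamma$. Two marked groups $(\Gamma,S)$, $(\Gamma',S')$ are identified if there is a group isomorphism $\Gamma\to\Gamma'$ sending $s_i$ to $s'_i$ for each $i$; $\mathcal{G}_k$ is the set of marked groups on $k$ generators up to this identification. Each marked group comes with the canonical epimorphism from the free group $\mathbb{F}_k$; a word $w\in\mathbb{F}_k$ "equals $1$ in $\Gamma$" if its image is trivial. The topology on $\mathcal{G}_k$ is given by the ultrametric $d\big((\Gamma_1,S_1),(\Gamma_2,S_2)\big)=e^{-\lambda}$ for distinct marked groups, where $\lambda$ is the length of a shortest element of $\mathbb{F}_k$ which is trivial in one of the groups and not in the other (and $d=0$ for equal marked groups). *)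

theory Defs
  imports "HOL-Algebra.Generated_Groups" "HOL-Analysis.Abstract_Metric_Spaces"
begin

section \<open>Free groups\<close>

text \<open>
  The letter \<open>(i, True)\<close> stands for the \<open>i\<close>-th generator (counting from 0) and \<open>(i, False)\<close> for
  its inverse. Elements of the free group are the freely reduced words, so the length of an element
  is the length of the list.
\<close>

type_synonym word = "(nat \<times> bool) list"

definition inv_letter :: "nat \<times> bool \<Rightarrow> nat \<times> bool"
  where "inv_letter x = (fst x, \<not> snd x)"

definition freely_reduced :: "word \<Rightarrow> bool"
  where "freely_reduced w \<longleftrightarrow> successively (\<lambda>x y. y \<noteq> inv_letter x) w"

definition cancel_cons :: "nat \<times> bool \<Rightarrow> word \<Rightarrow> word"
  where "cancel_cons x w = (if w \<noteq> [] \<and> hd w = inv_letter x then tl w else x # w)"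

definition reduce :: "word \<Rightarrow> word"
  where "reduce w = foldr cancel_cons w []"

definition free_group :: "nat \<Rightarrow> word monoid"
  where "free_group k =
    \<lparr>carrier = {w. set w \<subseteq> {..<k} \<times> UNIV \<and> freely_reduced w},
     mult = (\<lambda>u v. reduce (u @ v)), one = []\<rparr>"

definition free_gen :: "nat \<Rightarrow> word"
  where "free_gen i = [(i, True)]"


section \<open>Marked groups\<close>

type_synonym 'a marked = "'a monoid \<times> 'a list"

definition marked_group :: "nat \<Rightarrow> 'a marked \<Rightarrow> bool"
  where "marked_group k = (\<lambda>(G, S).
    group G \<and> length S = k \<and> set S \<subseteq> carrier G \<and> generate G (set S) = carrier G)"

definition marked_iso :: "'a marked \<Rightarrow> 'b marked \<Rightarrow> bool"
  where "marked_iso = (\<lambda>(G, S) (H, T). \<exists>h \<in> iso G H. map h S = T)"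

text \<open>The canonical epimorphism from the free group, see \<open>word_value_epi\<close> below.\<close>

definition letter_value :: "'a monoid \<Rightarrow> 'a list \<Rightarrow> nat \<times> bool \<Rightarrow> 'a"
  where "letter_value G S = (\<lambda>(i, b). if b then S ! i else inv\<^bsub>G\<^esub> (S ! i))"

definition word_value :: "'a monoid \<Rightarrow> 'a list \<Rightarrow> word \<Rightarrow> 'a"
  where "word_value G S w = foldr (\<lambda>x g. letter_value G S x \<otimes>\<^bsub>G\<^esub> g) w \<one>\<^bsub>G\<^esub>"

text \<open>
  Quantifying over all carrier types is impossible, so the points of the space of marked groups on
  \<open>k\<close> generators are the isomorphism classes of marked groups whose elements have type
  \<^typ>\<open>word set\<close>. This type has room for all quotients of free groups, and so the class of a
  marked group \<open>P\<close> over any type makes sense: it consists of the marked groups over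
  \<^typ>\<open>word set\<close> that are isomorphic to \<open>P\<close>. Nothing is lost in this way, see
  \<open>marked_class_in_space\<close> and \<open>marked_class_eq_iff\<close> below.
\<close>

definition marked_class :: "'a marked \<Rightarrow> word set marked set"
  where "marked_class P = {Q. marked_group (length (snd P)) Q \<and> marked_iso P Q}"

definition marked_space :: "nat \<Rightarrow> word set marked set set"
  where "marked_space k = marked_class ` {P :: word set marked. marked_group k P}"

definition trivial_in :: "word set marked set \<Rightarrow> word \<Rightarrow> bool"
  where "trivial_in X w \<longleftrightarrow> (\<exists>(G, S) \<in> X. word_value G S w = \<one>\<^bsub>G\<^esub>)"

definition marked_dist :: "nat \<Rightarrow> word set marked set \<Rightarrow> word set marked set \<Rightarrow> real"
  where "marked_dist k X Y =
    (if X = Y then 0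
     else exp (- real (LEAST l. \<exists>w \<in> carrier (free_group k).
                          length w = l \<and> trivial_in X w \<noteq> trivial_in Y w)))"


section \<open>Presentations and Baumslag-Solitar groups\<close>

definition normal_closure :: "('a, 'b) monoid_scheme \<Rightarrow> 'a set \<Rightarrow> 'a set"
  where "normal_closure G R = \<Inter> {N. N \<lhd> G \<and> R \<subseteq> N}"

definition presented_group :: "nat \<Rightarrow> word set \<Rightarrow> word set monoid"
  where "presented_group k R = free_group k Mod normal_closure (free_group k) R"

definition presented_gen :: "nat \<Rightarrow> word set \<Rightarrow> nat \<Rightarrow> word set"
  where "presented_gen k R i =
    normal_closure (free_group k) R #>\<^bsub>free_group k\<^esub> free_gen i"

definition marked_free :: "nat \<Rightarrow> word marked"
  where "marked_free k = (free_group k, map free_gen [0..<k])"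

definition marked_presented :: "nat \<Rightarrow> word set \<Rightarrow> word set marked"
  where "marked_presented k R = (presented_group k R, map (presented_gen k R) [0..<k])"

definition BS_relator :: "int \<Rightarrow> int \<Rightarrow> word"
  where "BS_relator m n =
    (let F = free_group 2; a = free_gen 0; b = free_gen 1
     in (a \<otimes>\<^bsub>F\<^esub> b [^]\<^bsub>F\<^esub> m \<otimes>\<^bsub>F\<^esub> inv\<^bsub>F\<^esub> a) \<otimes>\<^bsub>F\<^esub> inv\<^bsub>F\<^esub> (b [^]\<^bsub>F\<^esub> n))"

definition BS :: "int \<Rightarrow> int \<Rightarrow> word set marked"
  where "BS m n = marked_presented 2 {BS_relator m n}"


section \<open>Well-definedness\<close>

lemma inv_letter_simps [simp]:
  "inv_letter (inv_letter x) = x" "inv_letter x \<noteq> x" "x \<noteq> inv_letter x"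
  by (auto simp: inv_letter_def prod_eq_iff)

lemma inv_letter_mem: "inv_letter x \<in> A \<times> UNIV \<longleftrightarrow> x \<in> A \<times> UNIV"
  by (cases x) (auto simp: inv_letter_def)

lemma freely_reduced_cancel_cons:
  "freely_reduced w \<Longrightarrow> freely_reduced (cancel_cons x w)"
  by (cases w) (auto simp: cancel_cons_def freely_reduced_def successively_Cons)

lemma cancel_cons_inv:
  "freely_reduced w \<Longrightarrow> cancel_cons x (cancel_cons (inv_letter x) w) = w"
  by (cases w; cases "tl w") (auto simp: cancel_cons_def freely_reduced_def successively_Cons)

lemma freely_reduced_foldr:
  "freely_reduced v \<Longrightarrow> freely_reduced (foldr cancel_cons u v)"
  by (induction u) (auto simp: freely_reduced_cancel_cons)

lemma freely_reduced_reduce: "freely_reduced (reduce w)"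
  unfolding reduce_def by (rule freely_reduced_foldr) (simp add: freely_reduced_def)

lemma reduce_id: "freely_reduced w \<Longrightarrow> reduce w = w"
proof (induction w)
  case (Cons x w)
  then have "freely_reduced w" by (auto simp: freely_reduced_def successively_Cons)
  with Cons have "reduce w = w" by simp
  with Cons.prems show ?case
    by (auto simp: reduce_def cancel_cons_def freely_reduced_def successively_Cons)
qed (simp add: reduce_def)

lemma foldr_reduce:
  assumes "freely_reduced v"
  shows "foldr cancel_cons (reduce u) v = foldr cancel_cons u v"
proof (induction u)
  case (Cons x u)
  have *: "foldr cancel_cons (cancel_cons x r) v = cancel_cons x (foldr cancel_cons r v)" for r
    by (cases r) (auto simp: cancel_cons_def[of x "_ # _"] cancel_cons_def[of x "[]"]
          cancel_cons_inv freely_reduced_foldr assms)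
  show ?case using * Cons by (simp add: reduce_def)
qed (simp add: reduce_def)

lemma reduce_append: "reduce (u @ v) = foldr cancel_cons u (reduce v)"
  by (simp add: reduce_def)

lemma reduce_append_reduce [simp]:
  "reduce (u @ reduce v) = reduce (u @ v)" "reduce (reduce u @ v) = reduce (u @ v)"
  by (simp_all add: reduce_append reduce_id freely_reduced_reduce foldr_reduce)

lemma foldr_inverse:
  "freely_reduced v \<Longrightarrow>
     foldr cancel_cons (rev (map inv_letter w)) (foldr cancel_cons w v) = v"
proof (induction w)
  case (Cons x w)
  then show ?case
    using cancel_cons_inv[of "foldr cancel_cons w v" "inv_letter x"]
    by (simp add: freely_reduced_foldr)
qed simp

lemma set_cancel_cons: "set (cancel_cons x w) \<subseteq> insert x (set w)"
  by (cases w) (auto simp: cancel_cons_def)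

lemma set_reduce: "set (reduce w) \<subseteq> set w"
  unfolding reduce_def by (induction w) (use set_cancel_cons in \<open>fastforce+\<close>)

lemma reduce_in_carrier: "set w \<subseteq> {..<k} \<times> UNIV \<Longrightarrow> reduce w \<in> carrier (free_group k)"
  using set_reduce[of w] by (auto simp: free_group_def freely_reduced_reduce)

lemma group_free_group: "group (free_group k)"
proof (rule groupI)
  fix x y assume xy: "x \<in> carrier (free_group k)" "y \<in> carrier (free_group k)"
  then show "x \<otimes>\<^bsub>free_group k\<^esub> y \<in> carrier (free_group k)"
    using reduce_in_carrier[of "x @ y" k] by (auto simp: free_group_def)
next
  fix x assume x: "x \<in> carrier (free_group k)"
  have "reduce (rev (map inv_letter x)) \<in> carrier (free_group k)"
    using x by (intro reduce_in_carrier) (auto simp: free_group_def inv_letter_def)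
  moreover have "reduce (rev (map inv_letter x) @ x) = []"
    unfolding reduce_append by (simp add: reduce_def foldr_inverse freely_reduced_def)
  ultimately show "\<exists>y \<in> carrier (free_group k). y \<otimes>\<^bsub>free_group k\<^esub> x = \<one>\<^bsub>free_group k\<^esub>"
    by (intro bexI[of _ "reduce (rev (map inv_letter x))"]) (auto simp: free_group_def)
qed (auto simp: free_group_def reduce_id freely_reduced_def)

lemma marked_groupD:
  assumes "marked_group k (G, S)"
  shows "group G" "length S = k" "set S \<subseteq> carrier G" "generate G (set S) = carrier G"
  using assms by (auto simp: marked_group_def)

lemma letter_value_closed:
  assumes "group G" "length S = k" "set S \<subseteq> carrier G" "x \<in> {..<k} \<times> UNIV"
  shows "letter_value G S x \<in> carrier G"
  using assms by (cases x) (auto simp: letter_value_def subset_iff intro!: group.inv_closed)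

lemma word_value_closed:
  assumes "group G" "length S = k" "set S \<subseteq> carrier G" "set w \<subseteq> {..<k} \<times> UNIV"
  shows "word_value G S w \<in> carrier G"
proof -
  interpret group G by fact
  show ?thesis using assms(4)
    by (induction w) (auto simp: word_value_def letter_value_closed[OF assms(1-3)])
qed

lemma word_value_append:
  assumes "group G" "length S = k" "set S \<subseteq> carrier G"
    "set u \<subseteq> {..<k} \<times> UNIV" "set v \<subseteq> {..<k} \<times> UNIV"
  shows "word_value G S (u @ v) = word_value G S u \<otimes>\<^bsub>G\<^esub> word_value G S v"
proof -
  interpret group G by fact
  note wc = word_value_closed[OF assms(1-3)] and lc = letter_value_closed[OF assms(1-3)]
  show ?thesis using assms(4)
  proof (induction u)
    case Nil
    then show ?case using wc[OF assms(5)] by (simp add: word_value_def)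
  next
    case (Cons x u)
    then show ?case using wc[OF assms(5)] wc[of u] lc[of x]
      by (simp add: word_value_def m_assoc)
  qed
qed

lemma word_value_reduce:
  assumes "group G" "length S = k" "set S \<subseteq> carrier G" "set w \<subseteq> {..<k} \<times> UNIV"
  shows "word_value G S (reduce w) = word_value G S w"
proof -
  interpret group G by fact
  note wc = word_value_closed[OF assms(1-3)] and lc = letter_value_closed[OF assms(1-3)]
  have cancel: "word_value G S (cancel_cons x v) = letter_value G S x \<otimes>\<^bsub>G\<^esub> word_value G S v"
    if x: "x \<in> {..<k} \<times> UNIV" and v: "set v \<subseteq> {..<k} \<times> UNIV" for x v
  proof (cases "v \<noteq> [] \<and> hd v = inv_letter x")
    case True
    then obtain v' where v': "v = inv_letter x # v'" by (cases v) auto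
    have c: "word_value G S v' \<in> carrier G" using wc v v' by auto
    have "S ! fst x \<in> carrier G" using assms(2,3) x by (auto simp: subset_iff)
    then have "letter_value G S x \<otimes>\<^bsub>G\<^esub> letter_value G S (inv_letter x) = \<one>\<^bsub>G\<^esub>"
      by (cases x) (auto simp: letter_value_def inv_letter_def)
    then have "letter_value G S x \<otimes>\<^bsub>G\<^esub> word_value G S v = word_value G S v'"
      using c x lc[of x] lc[of "inv_letter x"]
      by (simp add: v' word_value_def m_assoc[symmetric] inv_letter_mem)
    then show ?thesis by (simp add: cancel_cons_def v')
  qed (simp only: cancel_cons_def if_False word_value_def foldr.simps o_apply)
  show ?thesis using assms(4)
  proof (induction w)
    case (Cons x w)
    moreover have "set (reduce w) \<subseteq> {..<k} \<times> UNIV"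
      using set_reduce[of w] Cons.prems by auto
    ultimately show ?case
      using cancel[of x "reduce w"] by (simp add: reduce_def word_value_def)
  qed (simp add: reduce_def)
qed

lemma word_value_hom:
  assumes "group G" "length S = k" "set S \<subseteq> carrier G"
  shows "word_value G S \<in> hom (free_group k) G"
  using word_value_closed[OF assms] word_value_append[OF assms] word_value_reduce[OF assms]
  by (auto simp: hom_def free_group_def)

lemma word_value_free_gen:
  assumes "group G" "length S = k" "set S \<subseteq> carrier G" "i < k"
  shows "word_value G S (free_gen i) = S ! i"
proof -
  interpret group G by fact
  show ?thesis using assms by (auto simp: word_value_def letter_value_def free_gen_def subset_iff)
qed

lemma free_gen_carrier: "i < k \<Longrightarrow> free_gen i \<in> carrier (free_group k)"
  by (auto simp: free_group_def free_gen_def freely_reduced_def)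

theorem word_value_epi:
  assumes "marked_group k (G, S)"
  shows "word_value G S \<in> epi (free_group k) G"
    and "i < k \<Longrightarrow> word_value G S (free_gen i) = S ! i"
proof -
  note D = marked_groupD[OF assms]
  interpret group G by (rule D)
  interpret h: group_hom "free_group k" G "word_value G S"
    using group_free_group word_value_hom[OF D(1-3)] D(1)
    by (intro group_hom.intro group_hom_axioms.intro)
  have "set S \<subseteq> word_value G S ` carrier (free_group k)"
  proof
    fix s assume "s \<in> set S"
    then obtain i where "i < k" "s = S ! i" using D(2) by (metis in_set_conv_nth)
    then show "s \<in> word_value G S ` carrier (free_group k)"
      using word_value_free_gen[OF D(1-3)] free_gen_carrier by (metis image_eqI)
  qed
  then have "carrier G \<subseteq> word_value G S ` carrier (free_group k)"
    using generate_subgroup_incl[OF _ h.img_is_subgroup] D(4) by metis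
  then show "word_value G S \<in> epi (free_group k) G"
    using h.homh by (auto simp: epi_def hom_def)
  show "i < k \<Longrightarrow> word_value G S (free_gen i) = S ! i"
    by (rule word_value_free_gen[OF D(1-3)])
qed

lemma word_value_map_hom:
  assumes "group G" "length S = k" "set S \<subseteq> carrier G" "group H" "h \<in> hom G H"
    "set w \<subseteq> {..<k} \<times> UNIV"
  shows "word_value H (map h S) w = h (word_value G S w)"
proof -
  interpret h: group_hom G H h
    using assms by (intro group_hom.intro group_hom_axioms.intro)
  show ?thesis using assms(6)
  proof (induction w)
    case Nil then show ?case by (simp add: word_value_def)
  next
    case (Cons x w)
    have "word_value G S w \<in> carrier G" "letter_value G S x \<in> carrier G"
      using word_value_closed[OF assms(1-3)] letter_value_closed[OF assms(1-3)] Cons.prems by auto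
    moreover have "letter_value H (map h S) x = h (letter_value G S x)"
      using Cons.prems assms(2,3) by (cases x) (auto simp: letter_value_def subset_iff)
    ultimately show ?case using Cons by (simp add: word_value_def)
  qed
qed

lemma group_mult_inv_eq_one:
  assumes "group G" "x \<in> carrier G" "y \<in> carrier G"
  shows "x \<otimes>\<^bsub>G\<^esub> inv\<^bsub>G\<^esub> y = \<one>\<^bsub>G\<^esub> \<longleftrightarrow> x = y"
  using assms by (metis group.inv_closed group.inv_equality group.inv_inv group.r_inv)

lemma marked_iso_iff:
  assumes P: "marked_group k (G, S)" and Q: "marked_group k (H, T)"
  shows "marked_iso (G, S) (H, T) \<longleftrightarrow>
    (\<forall>w \<in> carrier (free_group k).
       word_value G S w = \<one>\<^bsub>G\<^esub> \<longleftrightarrow> word_value H T w = \<one>\<^bsub>H\<^esub>)" (is "_ \<longleftrightarrow> ?R")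
proof
  note D = marked_groupD[OF P] and E = marked_groupD[OF Q]
  interpret G: group G by (rule D)
  interpret H: group H by (rule E)
  {
    assume "marked_iso (G, S) (H, T)"
    then obtain h where h: "h \<in> iso G H" "map h S = T" by (auto simp: marked_iso_def)
    then interpret h: group_hom G H h
      by (intro group_hom.intro group_hom_axioms.intro) (auto simp: iso_def D E)
    have inj: "inj_on h (carrier G)" using h by (auto simp: iso_def bij_betw_def)
    show ?R
    proof
      fix w assume "w \<in> carrier (free_group k)"
      then have w: "set w \<subseteq> {..<k} \<times> UNIV" by (simp add: free_group_def)
      have "word_value H T w = h (word_value G S w)"
        using word_value_map_hom[OF D(1-3) E(1) h.homh w] h(2) by simp
      then show "word_value G S w = \<one>\<^bsub>G\<^esub> \<longleftrightarrow> word_value H T w = \<one>\<^bsub>H\<^esub>"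
        using inj_on_eq_iff[OF inj word_value_closed[OF D(1-3) w] G.one_closed] by simp
    qed
  }
  {
    assume R: ?R
    define F where "F = free_group k"
    interpret F: group F unfolding F_def by (rule group_free_group)
    interpret p: group_hom F G "word_value G S"
      unfolding F_def using group_free_group word_value_hom[OF D(1-3)] D(1)
      by (intro group_hom.intro group_hom_axioms.intro)
    interpret q: group_hom F H "word_value H T"
      unfolding F_def using group_free_group word_value_hom[OF E(1-3)] E(1)
      by (intro group_hom.intro group_hom_axioms.intro)
    have surj: "word_value G S ` carrier F = carrier G" "word_value H T ` carrier F = carrier H"
      using word_value_epi(1)[OF P] word_value_epi(1)[OF Q] by (auto simp: epi_def F_def)
    have eq: "word_value G S u = word_value G S v \<longleftrightarrow> word_value H T u = word_value H T v"
      if "u \<in> carrier F" "v \<in> carrier F" for u v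
    proof -
      have "u \<otimes>\<^bsub>F\<^esub> inv\<^bsub>F\<^esub> v \<in> carrier F" using that by simp
      with R have "word_value G S (u \<otimes>\<^bsub>F\<^esub> inv\<^bsub>F\<^esub> v) = \<one>\<^bsub>G\<^esub> \<longleftrightarrow>
          word_value H T (u \<otimes>\<^bsub>F\<^esub> inv\<^bsub>F\<^esub> v) = \<one>\<^bsub>H\<^esub>" by (simp add: F_def)
      then show ?thesis using that D(1) E(1) by (simp add: group_mult_inv_eq_one)
    qed
    define r where "r = inv_into (carrier F) (word_value G S)"
    define h where "h = (\<lambda>g. word_value H T (r g))"
    have r: "r g \<in> carrier F" "word_value G S (r g) = g" if "g \<in> carrier G" for g
      using that surj(1) by (auto simp: r_def inv_into_into f_inv_into_f)
    have hval: "h (word_value G S w) = word_value H T w" if "w \<in> carrier F" for w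
      unfolding h_def using that eq r[of "word_value G S w"] by auto
    have "h \<in> hom G H"
    proof (rule homI)
      fix x y assume "x \<in> carrier G" "y \<in> carrier G"
      then obtain u v where uv: "u \<in> carrier F" "v \<in> carrier F"
        "x = word_value G S u" "y = word_value G S v" using surj(1) by blast
      then show "h (x \<otimes>\<^bsub>G\<^esub> y) = h x \<otimes>\<^bsub>H\<^esub> h y"
        using hval[of "u \<otimes>\<^bsub>F\<^esub> v"] hval by simp
    qed (simp add: h_def r)
    moreover have "inj_on h (carrier G)"
      by (intro inj_onI) (metis eq h_def r)
    moreover have "h ` carrier G = carrier H"
      using hval surj by (metis (no_types, lifting) image_cong image_image)
    ultimately have "h \<in> iso G H" by (auto simp: iso_def bij_betw_def)
    moreover have "map h S = T"
    proof (rule nth_equalityI)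
      fix i assume "i < length (map h S)"
      then have i: "i < k" using D(2) by simp
      then have "h (word_value G S (free_gen i)) = word_value H T (free_gen i)"
        using hval free_gen_carrier by (simp add: F_def)
      then show "map h S ! i = T ! i" using i D(2)
        by (simp add: word_value_epi(2)[OF P] word_value_epi(2)[OF Q])
    qed (use D E in simp)
    ultimately show "marked_iso (G, S) (H, T)" by (auto simp: marked_iso_def)
  }
qed

lemma word_value_free:
  assumes "w \<in> carrier (free_group k)"
  shows "word_value (free_group k) (map free_gen [0..<k]) w = w"
proof -
  let ?F = "free_group k"
  interpret F: group ?F by (rule group_free_group)
  have sub: "set w \<subseteq> {..<k} \<times> UNIV" using assms by (simp add: free_group_def)
  have "inv\<^bsub>?F\<^esub> (free_gen i) = [(i, False)]" if "i < k" for i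
    using that free_gen_carrier[OF that]
    by (intro F.inv_equality)
       (auto simp: free_group_def free_gen_def freely_reduced_def reduce_def cancel_cons_def
          inv_letter_def)
  then have letter: "letter_value ?F (map free_gen [0..<k]) x = [x]" if "x \<in> {..<k} \<times> UNIV" for x
    using that by (auto simp: letter_value_def free_gen_def)
  have "word_value ?F (map free_gen [0..<k]) w = reduce w"
    using sub
  proof (induction w)
    case (Cons x w)
    then have "word_value ?F (map free_gen [0..<k]) (x # w) = reduce ([x] @ reduce w)"
      using letter[of x] by (simp add: word_value_def) (simp add: free_group_def)
    then show ?case using reduce_append_reduce(1)[of "[x]" w] by simp
  qed (simp add: word_value_def free_group_def reduce_def)
  then show ?thesis using assms by (simp add: reduce_id free_group_def)
qed

lemma marked_free_marked_group: "marked_group k (marked_free k)"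
proof -
  let ?F = "free_group k" and ?S = "map free_gen [0..<k]"
  interpret F: group ?F by (rule group_free_group)
  have S: "set ?S \<subseteq> carrier ?F" using free_gen_carrier by auto
  have "word_value ?F ?S w \<in> generate ?F (set ?S)" if "set w \<subseteq> {..<k} \<times> UNIV" for w
    using that
  proof (induction w)
    case (Cons x w)
    have "letter_value ?F ?S x \<in> generate ?F (set ?S)"
      using Cons.prems
      by (cases x) (auto simp: letter_value_def intro!: generate.incl generate.inv)
    with Cons show ?case by (simp add: word_value_def generate.eng)
  qed (simp add: word_value_def generate.one)
  then have "carrier ?F \<subseteq> generate ?F (set ?S)"
    using word_value_free by (metis (no_types, lifting) free_group_def mem_Collect_eq
        partial_object.select_convs(1) subsetI)
  with F.generate_incl[OF S] S show ?thesis
    by (simp add: marked_group_def marked_free_def group_free_group)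
qed

lemma marked_group_quotient:
  assumes "N \<lhd> free_group k"
  shows "marked_group k (free_group k Mod N, map (\<lambda>i. N #>\<^bsub>free_group k\<^esub> free_gen i) [0..<k])"
proof -
  let ?F = "free_group k" and ?S = "map free_gen [0..<k]"
  let ?q = "\<lambda>g. N #>\<^bsub>?F\<^esub> g"
  interpret N: normal N ?F by fact
  interpret q: group_hom ?F "?F Mod N" ?q
    using N.r_coset_hom_Mod group_free_group N.factorgroup_is_group
    by (intro group_hom.intro group_hom_axioms.intro)
  have D: "generate ?F (set ?S) = carrier ?F" "set ?S \<subseteq> carrier ?F"
    using marked_free_marked_group[of k] by (auto simp: marked_group_def marked_free_def)
  have "generate (?F Mod N) (?q ` set ?S) = ?q ` carrier ?F"
    using q.generate_img[OF D(2)] D(1) by simp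
  also have "\<dots> = carrier (?F Mod N)" by (auto simp: FactGroup_def RCOSETS_def)
  finally show ?thesis using D(2) N.factorgroup_is_group
    by (auto simp: marked_group_def image_image FactGroup_def RCOSETS_def)
qed

lemma word_value_quotient:
  assumes "N \<lhd> free_group k" "w \<in> carrier (free_group k)"
  shows "word_value (free_group k Mod N) (map (\<lambda>i. N #>\<^bsub>free_group k\<^esub> free_gen i) [0..<k]) w
      = N #>\<^bsub>free_group k\<^esub> w"
proof -
  let ?F = "free_group k" and ?S = "map free_gen [0..<k]"
  interpret N: normal N ?F by fact
  have D: "length ?S = k" "set ?S \<subseteq> carrier ?F"
    using marked_free_marked_group[of k] by (auto simp: marked_group_def marked_free_def)
  have w: "set w \<subseteq> {..<k} \<times> UNIV" using assms by (simp add: free_group_def)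
  show ?thesis
    using word_value_map_hom[OF group_free_group D N.factorgroup_is_group N.r_coset_hom_Mod w]
      word_value_free[OF assms(2)] by (simp add: o_def)
qed

lemma normal_normal_closure:
  assumes "group G" "R \<subseteq> carrier G"
  shows "normal_closure G R \<lhd> G"
proof -
  interpret group G by fact
  have "carrier G \<lhd> G" by (simp add: normal_inv_iff subgroup_self)
  then have ne: "{N. N \<lhd> G \<and> R \<subseteq> N} \<noteq> {}" using assms(2) by blast
  have "subgroup (normal_closure G R) G"
    unfolding normal_closure_def
    by (rule subgroups_Inter[OF _ ne]) (auto simp: normal_imp_subgroup)
  then show ?thesis
    unfolding normal_inv_iff by (auto simp: normal_closure_def normal_inv_iff)
qed

lemma marked_presented_marked_group:
  assumes "R \<subseteq> carrier (free_group k)"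
  shows "marked_group k (marked_presented k R)"
  unfolding marked_presented_def presented_group_def presented_gen_def
  by (rule marked_group_quotient[OF normal_normal_closure[OF group_free_group assms]])

theorem BS_marked_group: "marked_group 2 (BS m n)"
proof -
  interpret F: group "free_group 2" by (rule group_free_group)
  have "free_gen 0 \<in> carrier (free_group 2)" "free_gen 1 \<in> carrier (free_group 2)"
    by (simp_all add: free_gen_carrier)
  then have "BS_relator m n \<in> carrier (free_group 2)" by (simp add: BS_relator_def Let_def)
  then show ?thesis unfolding BS_def by (intro marked_presented_marked_group) simp
qed

lemma marked_iso_refl: "marked_group k P \<Longrightarrow> marked_iso P P"
  using marked_iso_iff by (cases P) blast

lemma marked_iso_sym:
  "\<lbrakk>marked_group k P; marked_group k Q; marked_iso P Q\<rbrakk> \<Longrightarrow> marked_iso Q P"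
  by (cases P; cases Q) (auto simp: marked_iso_iff)

lemma marked_iso_trans:
  "\<lbrakk>marked_group k P; marked_group k Q; marked_group k R; marked_iso P Q; marked_iso Q R\<rbrakk>
     \<Longrightarrow> marked_iso P R"
  by (cases P; cases Q; cases R) (auto simp: marked_iso_iff)

lemma marked_group_length: "marked_group k P \<Longrightarrow> length (snd P) = k"
  by (auto simp: marked_group_def)

lemma marked_class_nonempty:
  assumes P: "marked_group k P"
  shows "\<exists>Q. marked_group k Q \<and> Q \<in> marked_class P"
proof -
  obtain G S where GS: "P = (G, S)" by (cases P)
  note D = marked_groupD[OF P[unfolded GS]]
  interpret p: group_hom "free_group k" G "word_value G S"
    using group_free_group word_value_hom[OF D(1-3)] D(1)
    by (intro group_hom.intro group_hom_axioms.intro)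
  let ?N = "kernel (free_group k) G (word_value G S)"
  have N: "?N \<lhd> free_group k" by (rule p.normal_kernel)
  then have sub: "subgroup ?N (free_group k)" by (rule normal_imp_subgroup)
  define Q where
    "Q = (free_group k Mod ?N, map (\<lambda>i. ?N #>\<^bsub>free_group k\<^esub> free_gen i) [0..<k])"
  have Q: "marked_group k Q" unfolding Q_def by (rule marked_group_quotient[OF N])
  have coset: "?N #>\<^bsub>free_group k\<^esub> w = ?N \<longleftrightarrow> word_value G S w = \<one>\<^bsub>G\<^esub>"
    if "w \<in> carrier (free_group k)" for w
  proof -
    have "?N #>\<^bsub>free_group k\<^esub> w = ?N \<longleftrightarrow> w \<in> ?N"
      using p.G.coset_join1[OF _ that sub] p.G.coset_join2[OF that sub] by blast
    also have "\<dots> \<longleftrightarrow> word_value G S w = \<one>\<^bsub>G\<^esub>"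
      using that by (simp add: kernel_def)
    finally show ?thesis .
  qed
  have "word_value (fst Q) (snd Q) w = \<one>\<^bsub>fst Q\<^esub> \<longleftrightarrow> word_value G S w = \<one>\<^bsub>G\<^esub>"
    if "w \<in> carrier (free_group k)" for w
  proof -
    have "word_value (fst Q) (snd Q) w = ?N #>\<^bsub>free_group k\<^esub> w"
      unfolding Q_def fst_conv snd_conv by (rule word_value_quotient[OF N that])
    moreover have "\<one>\<^bsub>fst Q\<^esub> = ?N" by (simp add: Q_def FactGroup_def)
    ultimately show ?thesis using coset[OF that] by (simp only:)
  qed
  then have "marked_iso P Q"
    using marked_iso_iff[of k G S "fst Q" "snd Q"] P Q by (simp add: GS)
  then have "Q \<in> marked_class P"
    using Q marked_group_length[OF P] by (simp add: marked_class_def)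
  with Q show ?thesis by blast
qed

theorem marked_class_eq_iff:
  assumes P: "marked_group k P" and Q: "marked_group k Q"
  shows "marked_class P = marked_class Q \<longleftrightarrow> marked_iso P Q"
proof
  assume eq: "marked_class P = marked_class Q"
  obtain R where "R \<in> marked_class P" "marked_group k R" using marked_class_nonempty[OF P] by blast
  with eq have "marked_iso P R" "marked_iso Q R" by (auto simp: marked_class_def)
  then show "marked_iso P Q"
    using P Q \<open>marked_group k R\<close> marked_iso_sym marked_iso_trans by metis
next
  assume "marked_iso P Q"
  then have "marked_iso P R \<longleftrightarrow> marked_iso Q R" if "marked_group k R" for R :: "word set marked"
    using P Q that marked_iso_sym marked_iso_trans by metis
  then show "marked_class P = marked_class Q"
    using P Q by (auto simp: marked_class_def marked_group_length)
qed

theorem marked_class_in_space: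
  assumes "marked_group k P"
  shows "marked_class P \<in> marked_space k"
proof -
  obtain Q where Q: "marked_group k Q" "Q \<in> marked_class P"
    using marked_class_nonempty[OF assms] by blast
  then have "marked_class P = marked_class Q"
    using marked_class_eq_iff[OF assms Q(1)] by (simp add: marked_class_def)
  then show ?thesis using Q by (auto simp: marked_space_def)
qed

theorem trivial_in_marked_class:
  assumes "marked_group k (G, S)" "w \<in> carrier (free_group k)"
  shows "trivial_in (marked_class (G, S)) w \<longleftrightarrow> word_value G S w = \<one>\<^bsub>G\<^esub>"
proof -
  have *: "word_value H T w = \<one>\<^bsub>H\<^esub> \<longleftrightarrow> word_value G S w = \<one>\<^bsub>G\<^esub>"
    if "(H, T) \<in> marked_class (G, S)" for H T
  proof -
    have "marked_group k (H, T)" "marked_iso (G, S) (H, T)"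
      using that marked_group_length[OF assms(1)] by (auto simp: marked_class_def)
    then show ?thesis using assms marked_iso_iff by metis
  qed
  obtain H T where "(H, T) \<in> marked_class (G, S)"
    using marked_class_nonempty[OF assms(1)] by auto
  with * show ?thesis unfolding trivial_in_def by blast
qed

lemma marked_space_eqI:
  assumes X: "X \<in> marked_space k" and Y: "Y \<in> marked_space k"
    and "\<And>w. w \<in> carrier (free_group k) \<Longrightarrow> trivial_in X w = trivial_in Y w"
  shows "X = Y"
proof -
  obtain G H :: "word set monoid" and S T where *: "X = marked_class (G, S)" "Y = marked_class (H, T)"
    "marked_group k (G, S)" "marked_group k (H, T)"
    using X Y unfolding marked_space_def by (metis imageE mem_Collect_eq prod.collapse)
  then show ?thesis
    using assms(3) marked_class_eq_iff[OF *(3,4)]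
    by (auto simp: marked_iso_iff[OF *(3,4)] trivial_in_marked_class)
qed

theorem marked_dist_ultrametric:
  assumes X: "X \<in> marked_space k" and Y: "Y \<in> marked_space k" and Z: "Z \<in> marked_space k"
  shows "marked_dist k X Z \<le> max (marked_dist k X Y) (marked_dist k Y Z)"
proof (cases "X = Z \<or> X = Y \<or> Y = Z")
  case True
  then show ?thesis by (auto simp: marked_dist_def le_max_iff_disj)
next
  case False
  define P where "P = (\<lambda>X Y l. \<exists>w \<in> carrier (free_group k).
      length w = l \<and> trivial_in X w \<noteq> trivial_in Y w)"
  define L where "L = (\<lambda>X Y. LEAST l. P X Y l)"
  have d: "marked_dist k X Y = exp (- real (L X Y))" if "X \<noteq> Y" for X Y
    using that by (simp add: marked_dist_def L_def P_def)
  have "\<exists>l. P X Z l" using marked_space_eqI[OF X Z] False unfolding P_def by blast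
  then have "P X Z (L X Z)" unfolding L_def by (rule LeastI_ex)
  then have "P X Y (L X Z) \<or> P Y Z (L X Z)" unfolding P_def by blast
  then have "L X Y \<le> L X Z \<or> L Y Z \<le> L X Z" unfolding L_def by (auto intro: Least_le)
  then show ?thesis using False d[of X Z] d[of X Y] d[of Y Z] by (simp add: le_max_iff_disj)
qed

theorem Metric_space_marked_space: "Metric_space (marked_space k) (marked_dist k)"
proof
  fix X Y
  show nonneg: "0 \<le> marked_dist k X Y" for X Y by (simp add: marked_dist_def)
  have "(\<lambda>l. \<exists>w \<in> carrier (free_group k). length w = l \<and> trivial_in X w \<noteq> trivial_in Y w) =
    (\<lambda>l. \<exists>w \<in> carrier (free_group k). length w = l \<and> trivial_in Y w \<noteq> trivial_in X w)"
    by blast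
  then show "marked_dist k X Y = marked_dist k Y X"
    unfolding marked_dist_def by metis
  show "marked_dist k X Y = 0 \<longleftrightarrow> X = Y" by (simp add: marked_dist_def)
  fix Z assume "X \<in> marked_space k" "Y \<in> marked_space k" "Z \<in> marked_space k"
  then show "marked_dist k X Z \<le> marked_dist k X Y + marked_dist k Y Z"
    using marked_dist_ultrametric[of X k Y Z] nonneg[of X Y] nonneg[of Y Z] by linarith
qed

end

theory Submission
  imports Defs "HOL-Algebra.Bij"
begin

text \<open>
  Only short words matter for the distance, so the theorem says that a nonempty freely reduced word
  shorter than both \<open>\<bar>m\<bar>\<close> and \<open>\<bar>n\<bar>\<close> is nontrivial in \<open>BS(m,n)\<close>. This is a case of Britton's lemma
  for an HNN extension of \<open>\<int> = \<langle>b\<rangle>\<close> with stable letter \<open>a\<close>: a word can only collapse at a pinch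
  \<open>a b\<^sup>i a\<^sup>-\<^sup>1\<close> with \<open>m\<close> dividing \<open>i\<close>, or \<open>a\<^sup>-\<^sup>1 b\<^sup>i a\<close> with \<open>n\<close> dividing \<open>i\<close>. Free reduction excludes
  \<open>i = 0\<close>, and any other multiple of \<open>m\<close> or \<open>n\<close> is too large an exponent for a short word.

  The proof follows van der Waerden's method. Let \<open>a\<close> and \<open>b\<close> act on the normal forms of \<open>BS(m,n)\<close> in
  the way that left multiplication would. These two permutations satisfy the defining relation
  (\<open>BS_relator_acts_trivially\<close>), so every word that is trivial in \<open>BS(m,n)\<close> fixes all normal forms
  (\<open>word_value_presented_trivial_imp\<close>). A short word, however, meets no pinch on its way from the
  empty normal form and does not fix it (\<open>short_word_moves_base_point\<close>).

  Both nonzero exponents are kept in one function \<open>c\<close> with \<open>c True = m\<close> and \<open>c False = n\<close>. The relation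
  \<open>a b\<^sup>m = b\<^sup>n a\<close> and its consequence \<open>a\<^sup>-\<^sup>1 b\<^sup>n = b\<^sup>m a\<^sup>-\<^sup>1\<close> then become one formula in the sign \<open>e\<close>
  of \<open>a\<close>, a power \<open>c e\<close> of \<open>b\<close> passing through to become a power \<open>c (\<not> e)\<close>, and every argument about
  \<open>a\<close> also covers its inverse.
\<close>

section \<open>Presented groups act wherever their relators act trivially\<close>

text \<open>
  Von Dyck's theorem in the form needed to detect nontrivial elements: the kernel of the evaluation
  map into \<open>G\<close> is a normal subgroup containing the relators, hence contains their normal closure.
\<close>

lemma word_value_presented_trivial_imp:
  assumes G: "group G" "length S = k" "set S \<subseteq> carrier G"
    and R: "R \<subseteq> carrier (free_group k)" "\<And>r. r \<in> R \<Longrightarrow> word_value G S r = \<one>\<^bsub>G\<^esub>"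
    and w: "w \<in> carrier (free_group k)"
    and triv: "word_value (presented_group k R) (map (presented_gen k R) [0..<k]) w
      = \<one>\<^bsub>presented_group k R\<^esub>"
  shows "word_value G S w = \<one>\<^bsub>G\<^esub>"
proof -
  let ?F = "free_group k"
  interpret p: group_hom ?F G "word_value G S"
    using group_free_group word_value_hom[OF G] G(1)
    by (intro group_hom.intro group_hom_axioms.intro)
  have N: "normal_closure ?F R \<lhd> ?F"
    by (rule normal_normal_closure[OF group_free_group R(1)])
  have gen: "presented_gen k R = (\<lambda>i. normal_closure ?F R #>\<^bsub>?F\<^esub> free_gen i)"
    by (simp add: presented_gen_def fun_eq_iff)
  have "normal_closure ?F R #>\<^bsub>?F\<^esub> w = normal_closure ?F R"
    using triv word_value_quotient[OF N w] gen by (simp add: presented_group_def FactGroup_def)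
  then have "w \<in> normal_closure ?F R"
    using p.G.coset_join1 w normal_imp_subgroup[OF N] by blast
  moreover have "R \<subseteq> kernel ?F G (word_value G S)"
    using R by (auto simp: kernel_def)
  ultimately show ?thesis
    using p.normal_kernel by (auto simp: normal_closure_def kernel_def)
qed


section \<open>Britton normal forms and the action on them\<close>

text \<open>
  The state \<open>(k, [(e\<^sub>1, r\<^sub>1), (e\<^sub>2, r\<^sub>2), \<dots>])\<close> stands for the product
  \<open>b\<^sup>k a\<^bsup>e\<^sub>1\<^esup> b\<^bsup>r\<^sub>1\<^esup> a\<^bsup>e\<^sub>2\<^esup> b\<^bsup>r\<^sub>2\<^esup> \<dots>\<close>, where \<open>True\<close> is the exponent \<open>1\<close> and \<open>False\<close> is \<open>-1\<close>.
\<close>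

type_synonym state = "int \<times> (bool \<times> int) list"

text \<open>
  Multiples of \<open>c e\<close> in an exponent after \<open>a\<^sup>e\<close> can be moved to the left of \<open>a\<^sup>e\<close>, so only a fixed system
  of residues remains there; its choice is that of \<open>mod\<close>, with the sign of \<open>c e\<close>. Once this is
  done, a pinch can only be an adjacent pair \<open>a\<^sup>e a\<^sup>-\<^sup>e\<close>.
\<close>

definition britton_reduced :: "(bool \<Rightarrow> int) \<Rightarrow> (bool \<times> int) list \<Rightarrow> bool"
  where "britton_reduced c l \<longleftrightarrow>
    (\<forall>(e, r) \<in> set l. r mod c e = r) \<and>
    successively (\<lambda>(e, r) (e', r'). r = 0 \<longrightarrow> e' = e) l"

definition normal_forms :: "(bool \<Rightarrow> int) \<Rightarrow> state set"
  where "normal_forms c = UNIV \<times> Collect (britton_reduced c)"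

text \<open>
  Left multiplication by \<open>a\<^sup>e\<close>: writing \<open>k = c e * q + r\<close>, the product \<open>a\<^sup>e b\<^sup>k\<close> equals
  \<open>b\<^bsup>c (\<not> e) * q\<^esup> a\<^sup>e b\<^sup>r\<close>, and \<open>a\<^sup>e\<close> cancels against a following \<open>a\<^sup>-\<^sup>e\<close> if \<open>r = 0\<close>.
\<close>

definition stable_step :: "(bool \<Rightarrow> int) \<Rightarrow> bool \<Rightarrow> state \<Rightarrow> state"
  where "stable_step c e = (\<lambda>(k, l).
    if k mod c e = 0 \<and> l \<noteq> [] \<and> fst (hd l) = (\<not> e)
    then (c (\<not> e) * (k div c e) + snd (hd l), tl l)
    else (c (\<not> e) * (k div c e), (e, k mod c e) # l))"

definition base_shift :: "int \<Rightarrow> state \<Rightarrow> state"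
  where "base_shift j = (\<lambda>(k, l). (k + j, l))"

lemma stable_step_closed:
  "s \<in> normal_forms c \<Longrightarrow> stable_step c e s \<in> normal_forms c"
  by (cases s; cases "snd s")
     (auto simp: normal_forms_def stable_step_def britton_reduced_def successively_Cons)

text \<open>
  This is where normal forms are needed rather than arbitrary states: after a cancelled letter
  \<open>(\<not> e, r)\<close>, the residue \<open>r\<close> is recovered by division with remainder, and the absence of pinches
  ensures that \<open>a\<^sup>-\<^sup>e\<close> is pushed back instead of cancelling in its turn.
\<close>

lemma stable_step_inverse:
  assumes "c (\<not> e) \<noteq> 0" and "s \<in> normal_forms c"
  shows "stable_step c (\<not> e) (stable_step c e s) = s"
proof -
  obtain k l where s: "s = (k, l)" by (cases s)
  have red: "britton_reduced c l" using assms(2) by (simp add: s normal_forms_def)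
  show ?thesis
  proof (cases "k mod c e = 0 \<and> l \<noteq> [] \<and> fst (hd l) = (\<not> e)")
    case True
    then obtain r l' where l: "l = (\<not> e, r) # l'" by (cases l) auto
    have r: "r mod c (\<not> e) = r" using red by (auto simp: l britton_reduced_def)
    have "r div c (\<not> e) = 0"
      using r assms(1) mult_div_mod_eq[of "c (\<not> e)" r] by simp
    moreover have "r = 0 \<Longrightarrow> l' \<noteq> [] \<Longrightarrow> fst (hd l') = (\<not> e)"
      using red by (cases l') (auto simp: l britton_reduced_def)
    ultimately show ?thesis
      using True r assms(1) by (auto simp: s l stable_step_def)
  next
    case False
    then show ?thesis using assms(1) by (auto simp: s stable_step_def)
  qed
qed

text \<open>
  The relation \<open>a\<^sup>e b\<^bsup>c e\<^esup> = b\<^bsup>c (\<not> e)\<^esup> a\<^sup>e\<close> as an identity between maps: adding \<open>c e\<close> to \<open>k\<close> raises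
  the quotient by one and keeps the remainder.
\<close>

lemma stable_step_base_shift:
  assumes "c e \<noteq> 0"
  shows "stable_step c e (base_shift (c e) s) = base_shift (c (\<not> e)) (stable_step c e s)"
  using assms by (cases s) (auto simp: stable_step_def base_shift_def algebra_simps)

lemma base_shift_closed: "s \<in> normal_forms c \<Longrightarrow> base_shift j s \<in> normal_forms c"
  by (auto simp: base_shift_def normal_forms_def)


text \<open>
  The group of bijections of \<open>X\<close> consists of functions that are undefined outside \<open>X\<close>, hence the
  restrictions.
\<close>

lemma BijGroup_restrict:
  assumes "\<And>x. x \<in> X \<Longrightarrow> f x \<in> X" "\<And>x. x \<in> X \<Longrightarrow> g x \<in> X"
    and "\<And>x. x \<in> X \<Longrightarrow> g (f x) = x" "\<And>x. x \<in> X \<Longrightarrow> f (g x) = x"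
  shows "restrict f X \<in> carrier (BijGroup X)"
    and "inv\<^bsub>BijGroup X\<^esub> (restrict f X) = restrict g X"
proof -
  interpret group "BijGroup X" by (rule group_BijGroup)
  have *: "restrict h X \<in> carrier (BijGroup X)"
    if "\<And>x. x \<in> X \<Longrightarrow> h x \<in> X" "\<And>x. x \<in> X \<Longrightarrow> h' x \<in> X"
      "\<And>x. x \<in> X \<Longrightarrow> h' (h x) = x" "\<And>x. x \<in> X \<Longrightarrow> h (h' x) = x" for h h'
    using that by (auto simp: BijGroup_def Bij_def intro!: bij_betw_byWitness[where f' = h'])
  show f: "restrict f X \<in> carrier (BijGroup X)" using assms by (intro *[of f g])
  have g: "restrict g X \<in> carrier (BijGroup X)" using assms by (intro *[of g f])
  have "restrict g X \<otimes>\<^bsub>BijGroup X\<^esub> restrict f X = \<one>\<^bsub>BijGroup X\<^esub>"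
    using f g assms by (auto simp: BijGroup_def compose_def fun_eq_iff)
  then show "inv\<^bsub>BijGroup X\<^esub> (restrict f X) = restrict g X"
    using f g by (intro inv_equality)
qed

lemma BijGroup_mult_restrict:
  assumes "restrict f X \<in> carrier (BijGroup X)" "restrict g X \<in> carrier (BijGroup X)"
    and "\<And>x. x \<in> X \<Longrightarrow> g x \<in> X"
  shows "restrict f X \<otimes>\<^bsub>BijGroup X\<^esub> restrict g X = restrict (\<lambda>x. f (g x)) X"
  using assms by (auto simp: BijGroup_def compose_def fun_eq_iff)

definition BS_permutations :: "(bool \<Rightarrow> int) \<Rightarrow> (state \<Rightarrow> state) list"
  where "BS_permutations c =
    [restrict (stable_step c True) (normal_forms c), restrict (base_shift 1) (normal_forms c)]"

definition letter_action :: "(bool \<Rightarrow> int) \<Rightarrow> nat \<times> bool \<Rightarrow> state \<Rightarrow> state"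
  where "letter_action c = (\<lambda>(i, b).
    if i = 0 then stable_step c b else base_shift (if b then 1 else -1))"

lemma restrict_stable_step:
  assumes "\<And>e. c e \<noteq> 0"
  shows "restrict (stable_step c e) (normal_forms c) \<in> carrier (BijGroup (normal_forms c))"
    and "inv\<^bsub>BijGroup (normal_forms c)\<^esub> (restrict (stable_step c e) (normal_forms c))
      = restrict (stable_step c (\<not> e)) (normal_forms c)"
proof -
  have inv: "stable_step c (\<not> e) (stable_step c e s) = s"
    "stable_step c e (stable_step c (\<not> e) s) = s" if "s \<in> normal_forms c" for s
    using stable_step_inverse[of c e s] stable_step_inverse[of c "\<not> e" s] that assms by simp_all
  note BijGroup_restrict[of "normal_forms c" "stable_step c e" "stable_step c (\<not> e)",
      OF stable_step_closed stable_step_closed inv]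
  then show "restrict (stable_step c e) (normal_forms c) \<in> carrier (BijGroup (normal_forms c))"
    and "inv\<^bsub>BijGroup (normal_forms c)\<^esub> (restrict (stable_step c e) (normal_forms c))
      = restrict (stable_step c (\<not> e)) (normal_forms c)"
    by blast+
qed

lemma restrict_base_shift:
  shows "restrict (base_shift j) (normal_forms c) \<in> carrier (BijGroup (normal_forms c))"
    and "inv\<^bsub>BijGroup (normal_forms c)\<^esub> (restrict (base_shift j) (normal_forms c))
      = restrict (base_shift (- j)) (normal_forms c)"
proof -
  have "base_shift (- j) (base_shift j s) = s" "base_shift j (base_shift (- j) s) = s" for s
    by (simp_all add: base_shift_def split: prod.split)
  note BijGroup_restrict[of "normal_forms c" "base_shift j" "base_shift (- j)",
      OF base_shift_closed base_shift_closed this]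
  then show "restrict (base_shift j) (normal_forms c) \<in> carrier (BijGroup (normal_forms c))"
    and "inv\<^bsub>BijGroup (normal_forms c)\<^esub> (restrict (base_shift j) (normal_forms c))
      = restrict (base_shift (- j)) (normal_forms c)"
    by blast+
qed

lemma restrict_base_shift_int_pow:
  "restrict (base_shift 1) (normal_forms c) [^]\<^bsub>BijGroup (normal_forms c)\<^esub> (j :: int)
    = restrict (base_shift j) (normal_forms c)"
proof -
  let ?X = "normal_forms c"
  let ?b = "restrict (base_shift 1) ?X"
  interpret group "BijGroup ?X" by (rule group_BijGroup)
  note b = restrict_base_shift(1)[of _ c]
  have add: "restrict (base_shift i) ?X \<otimes>\<^bsub>BijGroup ?X\<^esub> restrict (base_shift j) ?X
      = restrict (base_shift (i + j)) ?X" for i j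
    using BijGroup_mult_restrict[OF b b base_shift_closed] by (auto simp: base_shift_def fun_eq_iff)
  show ?thesis
  proof (induction j rule: int_induct[where k = 0])
    case base
    show ?case by (auto simp: BijGroup_def base_shift_def fun_eq_iff)
  next
    case (step1 i)
    have "?b [^]\<^bsub>BijGroup ?X\<^esub> (i + 1) = ?b [^]\<^bsub>BijGroup ?X\<^esub> i \<otimes>\<^bsub>BijGroup ?X\<^esub> ?b"
      using int_pow_mult[OF b, of 1 i 1] unfolding int_pow_1[OF b] .
    then show ?case unfolding step1 add .
  next
    case (step2 i)
    have "?b [^]\<^bsub>BijGroup ?X\<^esub> (i - 1)
        = ?b [^]\<^bsub>BijGroup ?X\<^esub> i \<otimes>\<^bsub>BijGroup ?X\<^esub> inv\<^bsub>BijGroup ?X\<^esub> ?b"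
      using int_pow_diff[OF b, of 1 i 1] unfolding int_pow_1[OF b] .
    then show ?case unfolding step2 restrict_base_shift(2) add by (simp only: diff_conv_add_uminus)
  qed
qed

lemma BS_permutations_marking:
  assumes "\<And>e. c e \<noteq> 0"
  shows "length (BS_permutations c) = 2"
    and "set (BS_permutations c) \<subseteq> carrier (BijGroup (normal_forms c))"
  using restrict_stable_step(1)[of c, OF assms] restrict_base_shift(1)
  by (auto simp: BS_permutations_def)

text \<open>
  Words act by left multiplication, so the last letter of a word acts first. This makes the image of
  a state under a word computable by recursion on the word.
\<close>

lemma word_value_BS_permutations:
  assumes c: "\<And>e. c e \<noteq> 0" and w: "set w \<subseteq> {..<2} \<times> UNIV"
  shows "word_value (BijGroup (normal_forms c)) (BS_permutations c) w
    = restrict (foldr (letter_action c) w) (normal_forms c)"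
  using w
proof (induction w)
  case Nil
  show ?case by (auto simp: word_value_def BijGroup_def fun_eq_iff)
next
  case (Cons x w)
  let ?X = "normal_forms c"
  let ?G = "BijGroup ?X"
  obtain i b where x: "x = (i, b)" and i: "i = 0 \<or> i = 1"
    using Cons.prems by (cases x) (auto simp: less_2_cases_iff)
  have letter: "letter_value ?G (BS_permutations c) x = restrict (letter_action c x) ?X"
    using i restrict_stable_step(2)[of c True, OF c] restrict_base_shift(2)[of c 1]
    by (auto simp: x letter_value_def BS_permutations_def letter_action_def simp del: restrict_apply)
  have closed: "foldr (letter_action c) v s \<in> ?X" if "s \<in> ?X" for v s
    using that by (induction v)
      (auto simp: letter_action_def stable_step_closed base_shift_closed split: prod.split)
  note M = BS_permutations_marking[of c, OF c]
  have "letter_value ?G (BS_permutations c) x \<in> carrier ?G"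
    using Cons.prems by (intro letter_value_closed[OF group_BijGroup M]) auto
  moreover have "word_value ?G (BS_permutations c) w \<in> carrier ?G"
    using Cons.prems by (intro word_value_closed[OF group_BijGroup M]) auto
  moreover have IH: "word_value ?G (BS_permutations c) w = restrict (foldr (letter_action c) w) ?X"
    using Cons.prems by (intro Cons.IH) auto
  ultimately have mult: "restrict (letter_action c x) ?X \<otimes>\<^bsub>?G\<^esub> restrict (foldr (letter_action c) w) ?X
      = restrict (\<lambda>s. letter_action c x (foldr (letter_action c) w s)) ?X"
    using closed by (intro BijGroup_mult_restrict) (simp_all only: letter)
  have "word_value ?G (BS_permutations c) (x # w)
      = letter_value ?G (BS_permutations c) x \<otimes>\<^bsub>?G\<^esub> word_value ?G (BS_permutations c) w"
    by (simp add: word_value_def)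
  also have "\<dots> = restrict (foldr (letter_action c) (x # w)) ?X"
    unfolding letter IH mult by (simp add: o_def)
  finally show ?case .
qed

lemma BS_relator_carrier: "BS_relator m n \<in> carrier (free_group 2)"
proof -
  interpret F: group "free_group 2" by (rule group_free_group)
  show ?thesis by (simp add: BS_relator_def Let_def free_gen_carrier)
qed

lemma BS_relator_acts_trivially:
  assumes c: "\<And>e. c e \<noteq> 0"
  shows "word_value (BijGroup (normal_forms c)) (BS_permutations c)
      (BS_relator (c True) (c False)) = \<one>\<^bsub>BijGroup (normal_forms c)\<^esub>"
proof -
  let ?X = "normal_forms c"
  let ?G = "BijGroup ?X"
  let ?a = "restrict (stable_step c True) ?X" and ?b = "restrict (base_shift 1) ?X"
  note M = BS_permutations_marking[of c, OF c]
  interpret h: group_hom "free_group 2" ?G "word_value ?G (BS_permutations c)"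
    using group_free_group word_value_hom[OF group_BijGroup M] group_BijGroup
    by (intro group_hom.intro group_hom_axioms.intro)
  note a = restrict_stable_step(1)[of c True, OF c] and b = restrict_base_shift(1)[of _ c]
  have gens: "word_value ?G (BS_permutations c) (free_gen 0) = ?a"
    "word_value ?G (BS_permutations c) (free_gen 1) = ?b"
    using word_value_free_gen[OF group_BijGroup M] by (simp_all add: BS_permutations_def)
  have "?a \<otimes>\<^bsub>?G\<^esub> ?b [^]\<^bsub>?G\<^esub> c True = ?b [^]\<^bsub>?G\<^esub> c False \<otimes>\<^bsub>?G\<^esub> ?a"
    unfolding restrict_base_shift_int_pow
    using BijGroup_mult_restrict[OF a b] BijGroup_mult_restrict[OF b a]
      stable_step_base_shift[of c True, OF c]
    by (simp add: base_shift_closed stable_step_closed)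
  then have "(?a \<otimes>\<^bsub>?G\<^esub> ?b [^]\<^bsub>?G\<^esub> c True) \<otimes>\<^bsub>?G\<^esub> inv\<^bsub>?G\<^esub> ?a = ?b [^]\<^bsub>?G\<^esub> c False"
    using a b by (simp add: h.H.m_assoc)
  then show ?thesis
    using a b by (simp add: BS_relator_def Let_def free_gen_carrier h.hom_int_pow gens del: One_nat_def)
qed

section \<open>Short reduced words act without cancellation\<close>

text \<open>
  The invariant behind Britton's lemma for short words. Let \<open>b\<^sup>i\<close>, with \<open>i = \<plusminus>j\<close>, be the maximal power
  of \<open>b\<close> at the front of \<open>w\<close>; free reduction gives it a constant sign. Each letter \<open>a\<^sup>e\<close> has pushed an
  entry and left a multiple of \<open>c (\<not> e)\<close> as the new first component, to which the letters of \<open>b\<close>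
  read since then have added \<open>i\<close>. So the latest \<open>a\<^sup>e\<close> is on top and \<open>k\<close> is congruent to \<open>i\<close> modulo
  \<open>c (\<not> e)\<close>, which is exactly the modulus that decides whether a next letter \<open>a\<^sup>-\<^sup>e\<close> cancels.
  As \<open>j\<close> is less than the absolute value of that modulus, cancellation would force \<open>i = 0\<close>, that is, \<open>a\<^sup>-\<^sup>e\<close>
  directly in front of \<open>a\<^sup>e\<close>.
\<close>

lemma short_word_trajectory:
  assumes "freely_reduced w" "set w \<subseteq> {..<2} \<times> UNIV" "\<And>e. int (length w) < \<bar>c e\<bar>"
  shows "\<exists>j b u k l. w = replicate j (1, b) @ u \<and> foldr (letter_action c) w (0, []) = (k, l) \<and>
    (u = [] \<and> l = [] \<and> k = (if b then int j else - int j) \<or>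
     (\<exists>e u' r l'. u = (0, e) # u' \<and> l = (e, r) # l' \<and>
        c (\<not> e) dvd k - (if b then int j else - int j)))"
  using assms
proof (induction w)
  case Nil
  show ?case by simp
next
  case (Cons x w)
  have "freely_reduced w" "set w \<subseteq> {..<2} \<times> UNIV"
    using Cons.prems by (auto simp: freely_reduced_def successively_Cons)
  moreover have "int (length w) < \<bar>c e\<bar>" for e
    using Cons.prems(3)[of e] by simp
  ultimately obtain j b u k l where w: "w = replicate j (1, b) @ u"
    and act: "foldr (letter_action c) w (0, []) = (k, l)"
    and inv: "u = [] \<and> l = [] \<and> k = (if b then int j else - int j) \<or>
     (\<exists>e u' r l'. u = (0, e) # u' \<and> l = (e, r) # l' \<and>
        c (\<not> e) dvd k - (if b then int j else - int j))"
    using Cons.IH by blast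
  obtain i b' where x: "x = (i, b')" and i: "i = 0 \<or> i = 1"
    using Cons.prems(2) by (cases x) (auto simp: less_2_cases_iff)
  show ?case
  proof (cases "i = 0")
    case False
    then have i: "i = 1" using i by simp
    \<comment> \<open>If \<open>w\<close> does not begin with a power of \<open>b\<close>, then \<open>j = 0\<close> and the sign \<open>b\<close> says nothing.\<close>
    have b: "b = b' \<or> j = 0"
      using Cons.prems(1) by (cases j) (auto simp: w x i freely_reduced_def inv_letter_def)
    have 1: "x # w = replicate (Suc j) (1, b') @ u" using b by (auto simp: w x i)
    have 2: "foldr (letter_action c) (x # w) (0, []) = (k + (if b' then 1 else -1), l)"
      unfolding foldr_Cons o_apply act by (simp add: x i letter_action_def base_shift_def)
    have 3: "u = [] \<and> l = [] \<and> k + (if b' then 1 else -1) = (if b' then int (Suc j) else - int (Suc j)) \<or>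
     (\<exists>e u' r l'. u = (0, e) # u' \<and> l = (e, r) # l' \<and>
        c (\<not> e) dvd k + (if b' then 1 else -1) - (if b' then int (Suc j) else - int (Suc j)))"
      using inv b by (auto split: if_splits)
    show ?thesis using 1 2 3 by blast
  next
    case True
    have no_pinch: "\<not> (k mod c b' = 0 \<and> l \<noteq> [] \<and> fst (hd l) = (\<not> b'))"
    proof
      assume pinch: "k mod c b' = 0 \<and> l \<noteq> [] \<and> fst (hd l) = (\<not> b')"
      with inv obtain u' where u: "u = (0, \<not> b') # u'"
        and d: "c b' dvd k - (if b then int j else - int j)" by auto
      have "c b' dvd k" using pinch by auto
      then have "c b' dvd int j"
        using d by (auto simp: dvd_diff_right_iff dvd_add_right_iff split: if_splits)
      moreover have "int j < \<bar>c b'\<bar>" using Cons.prems(3)[of b'] by (simp add: w)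
      ultimately have "j = 0"
        using dvd_imp_le_int[of "int j" "c b'"] by fastforce
      then show False
        using Cons.prems(1) by (simp add: w u x True freely_reduced_def inv_letter_def)
    qed
    have "foldr (letter_action c) (x # w) (0, []) =
        (c (\<not> b') * (k div c b'), (b', k mod c b') # l)"
      unfolding foldr_Cons o_apply act
      using no_pinch by (auto simp: x True letter_action_def stable_step_def)
    moreover have "x # w = replicate 0 (1, b) @ (0, b') # w" by (simp add: x True)
    ultimately show ?thesis
      by - (rule exI[of _ 0], rule exI[of _ b], rule exI[of _ "(0, b') # w"], simp)
  qed
qed

text \<open>
  Either the word contains the letter \<open>a\<close> or its inverse, and then the list has become nonempty and
  stays so, or it is a nonzero power of \<open>b\<close>.
\<close>

lemma short_word_moves_base_point:
  assumes "freely_reduced w" "set w \<subseteq> {..<2} \<times> UNIV" "\<And>e. int (length w) < \<bar>c e\<bar>" "w \<noteq> []"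
  shows "foldr (letter_action c) w (0, []) \<noteq> (0, [])"
proof -
  obtain j b u k l where "w = replicate j (1, b) @ u" "foldr (letter_action c) w (0, []) = (k, l)"
    "u = [] \<and> l = [] \<and> k = (if b then int j else - int j) \<or> l \<noteq> []"
    using short_word_trajectory[of w c, OF assms(1-3)] by blast
  then show ?thesis using assms(4) by (cases j) (auto split: if_splits)
qed

theorem short_word_nontrivial_in_BS:
  assumes w: "w \<in> carrier (free_group 2)" "w \<noteq> []"
    and len: "int (length w) < \<bar>m\<bar>" "int (length w) < \<bar>n\<bar>"
  shows "\<not> trivial_in (marked_class (BS m n)) w"
proof
  assume triv: "trivial_in (marked_class (BS m n)) w"
  define c where "c = (\<lambda>e. if e then m else n)"
  have short: "int (length w) < \<bar>c e\<bar>" for e using len by (simp add: c_def)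
  have c: "c e \<noteq> 0" for e using short[of e] by auto
  have red: "freely_reduced w" "set w \<subseteq> {..<2} \<times> UNIV" using w by (auto simp: free_group_def)
  let ?R = "{BS_relator m n}"
  have "word_value (presented_group 2 ?R) (map (presented_gen 2 ?R) [0..<2]) w
      = \<one>\<^bsub>presented_group 2 ?R\<^esub>"
    using triv trivial_in_marked_class[OF BS_marked_group[of m n, unfolded BS_def marked_presented_def] w(1)]
    by (simp add: BS_def marked_presented_def)
  moreover have "word_value (BijGroup (normal_forms c)) (BS_permutations c) r
      = \<one>\<^bsub>BijGroup (normal_forms c)\<^esub>" if "r \<in> ?R" for r
    using that BS_relator_acts_trivially[of c, OF c] by (simp add: c_def)
  ultimately have "word_value (BijGroup (normal_forms c)) (BS_permutations c) w
      = \<one>\<^bsub>BijGroup (normal_forms c)\<^esub>"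
    using word_value_presented_trivial_imp[OF group_BijGroup BS_permutations_marking[of c, OF c],
        of ?R w] BS_relator_carrier[of m n] w(1) by blast
  then have "restrict (foldr (letter_action c) w) (normal_forms c) = (\<lambda>s \<in> normal_forms c. s)"
    unfolding word_value_BS_permutations[of c w, OF c red(2)] by (simp only: BijGroup_def monoid.simps)
  then have "foldr (letter_action c) w s = s" if "s \<in> normal_forms c" for s
    using that by (metis restrict_apply')
  moreover have "(0, []) \<in> normal_forms c" by (simp add: normal_forms_def britton_reduced_def)
  ultimately have "foldr (letter_action c) w (0, []) = (0, [])" by blast
  then show False
    using short_word_moves_base_point[of w c, OF red short w(2)] by blast
qed


section \<open>Convergence\<close>

lemma trivial_in_marked_free_iff:
  assumes "w \<in> carrier (free_group k)"
  shows "trivial_in (marked_class (marked_free k)) w \<longleftrightarrow> w = []"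
  using trivial_in_marked_class[OF marked_free_marked_group[of k, unfolded marked_free_def] assms]
    word_value_free[OF assms]
  by (simp add: marked_free_def) (simp add: free_group_def)

lemma trivial_in_Nil:
  assumes "marked_group k P"
  shows "trivial_in (marked_class P) []"
proof -
  obtain G S where "P = (G, S)" by (cases P)
  then show ?thesis
    using trivial_in_marked_class[of k G S "[]"] assms
    by (simp add: free_group_def freely_reduced_def word_value_def)
qed

lemma marked_dist_le_exp:
  assumes X: "X \<in> marked_space k" and Y: "Y \<in> marked_space k"
    and agree: "\<And>w. \<lbrakk>w \<in> carrier (free_group k); length w < N\<rbrakk> \<Longrightarrow> trivial_in X w = trivial_in Y w"
  shows "marked_dist k X Y \<le> exp (- real N)"
proof (cases "X = Y")
  case False
  let ?P = "\<lambda>l. \<exists>w \<in> carrier (free_group k). length w = l \<and> trivial_in X w \<noteq> trivial_in Y w"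
  define L where "L = (LEAST l. ?P l)"
  have "\<exists>l. ?P l" using marked_space_eqI[OF X Y] False by blast
  then have "?P L" unfolding L_def by (rule LeastI_ex)
  then have "N \<le> L" using agree not_le by blast
  moreover have "marked_dist k X Y = exp (- real L)"
    using False by (simp add: marked_dist_def L_def)
  ultimately show ?thesis by simp
qed (simp add: marked_dist_def)

theorem theorem1:
  shows "\<forall>\<epsilon>>0::real. \<exists>N::nat. \<forall>m n :: int.
    m \<noteq> 0 \<longrightarrow> n \<noteq> 0 \<longrightarrow> \<bar>m\<bar> \<ge> int N \<longrightarrow> \<bar>n\<bar> \<ge> int N \<longrightarrow>
      marked_dist 2 (marked_class (BS m n)) (marked_class (marked_free 2)) < \<epsilon>"
proof (intro allI impI)
  fix \<epsilon> :: real
  assume "\<epsilon> > 0"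
  \<comment> \<open>Agreement on all words shorter than \<open>N\<close> gives distance at most \<open>exp (- N)\<close>.\<close>
  obtain N :: nat where "- ln \<epsilon> < real N" using reals_Archimedean2 by blast
  then have "exp (- real N) < exp (ln \<epsilon>)" by simp
  then have N: "exp (- real N) < \<epsilon>" using \<open>\<epsilon> > 0\<close> by simp
  have "marked_dist 2 (marked_class (BS m n)) (marked_class (marked_free 2)) \<le> exp (- real N)"
    if "int N \<le> \<bar>m\<bar>" "int N \<le> \<bar>n\<bar>" for m n
  proof (rule marked_dist_le_exp)
    show "marked_class (BS m n) \<in> marked_space 2" "marked_class (marked_free 2) \<in> marked_space 2"
      by (intro marked_class_in_space BS_marked_group marked_free_marked_group)+
    fix w assume w: "w \<in> carrier (free_group 2)" "length w < N"
    then show "trivial_in (marked_class (BS m n)) w = trivial_in (marked_class (marked_free 2)) w"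
      using short_word_nontrivial_in_BS[of w m n] trivial_in_Nil[OF BS_marked_group[of m n]] that
      by (cases "w = []") (auto simp: trivial_in_marked_free_iff)
  qed
  with N show "\<exists>N::nat. \<forall>m n :: int. m \<noteq> 0 \<longrightarrow> n \<noteq> 0 \<longrightarrow> \<bar>m\<bar> \<ge> int N \<longrightarrow> \<bar>n\<bar> \<ge> int N \<longrightarrow>
      marked_dist 2 (marked_class (BS m n)) (marked_class (marked_free 2)) < \<epsilon>"
    by (meson order.strict_trans1)
qed

end
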